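(* Let $n\ge 3$ be an integer. For an $n$-simplex $T$ in $\mathbb{E}^n$ with vertices $v_1,\dots,v_{n+1}$, let $\ell_{ij}=\Vert v_i-v_j\Vert_2$ ($1\le i<j\le n+1$) be its edge-lengths, and for each $(n-1)$-element subset $F\subseteq\{1,\dots,n+1\}$ let $Y_F$ be the $(n-2)$-dimensional volume of the $(n-2)$-face $\mathrm{conv}\{v_i : i\in F\}$. Regard each $Y_F$ as a function of the vector $\ell=(\ell_{ij})_{1\le i<j\le n+1}$, defined on the open set of edge-length vectors of nondegenerate $n$-simplices. Then the $\binom{n+1}{2}$ functions $Y_F$ are algebraically independent: there is no nonzero polynomial $P$ with complex coefficients in $\binom{n+1}{2}$ variables such that $P\big((Y_F(\ell))_F\big)=0$ for all such $\ell$.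
   Context: A simplex is determined up to congruence by its $\binom{n+1}{2}$ edge-lengths, and the volume of each $(n-2)$-face is a function of the edge-lengths of that face. *)

theory Defs
  imports "HOL-Analysis.Analysis" "HOL-Library.Poly_Mapping"
begin

definition mpoly_eval :: "(('v \<Rightarrow>\<^sub>0 nat) \<Rightarrow>\<^sub>0 complex) \<Rightarrow> ('v \<Rightarrow> complex) \<Rightarrow> complex" where
  "mpoly_eval P x = (\<Sum>mon\<in>Poly_Mapping.keys P. Poly_Mapping.lookup P mon * (\<Prod>y\<in>Poly_Mapping.keys mon. x y ^ Poly_Mapping.lookup mon y))"

definition mpoly_vars :: "(('v \<Rightarrow>\<^sub>0 nat) \<Rightarrow>\<^sub>0 complex) \<Rightarrow> 'v set" where
  "mpoly_vars P = (\<Union>m\<in>Poly_Mapping.keys P. Poly_Mapping.keys m)"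

definition nondeg_simplex :: "(nat \<Rightarrow> real ^ 'n) \<Rightarrow> bool" where
  "nondeg_simplex v \<longleftrightarrow> inj_on v {0..CARD('n)} \<and> \<not> affine_dependent (v ` {0..CARD('n)})"

definition codim2_faces :: "nat \<Rightarrow> nat set set" where
  "codim2_faces n = {F. F \<subseteq> {0..n} \<and> card F = n - 1}"

text \<open>k-dimensional volume of the simplex conv {v i | i \<in> F} (k = card F - 1),
  via the Gram determinant of the edge vectors from the base vertex Min F:
  vol = sqrt (det Gram) / k!.  The determinant is written by the Leibniz formula.\<close>

definition gram_det :: "'i set \<Rightarrow> ('i \<Rightarrow> 'a::real_inner) \<Rightarrow> real" where
  "gram_det S u = (\<Sum>p | p permutes S. of_int (sign p) * (\<Prod>i\<in>S. inner (u i) (u (p i))))"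

definition face_volume :: "(nat \<Rightarrow> real ^ 'n) \<Rightarrow> nat set \<Rightarrow> real" where
  "face_volume v F =
     (let i0 = Min F; S = F - {i0}
      in sqrt (gram_det S (\<lambda>i. v i - v i0)) / fact (card S))"

end

(* At the regular simplex the derivative of Y_F is a nonzero multiple of the sum of the variations
   of the edge lengths in F. Indexing codimension-2 faces by the complementary pairs, the Jacobian
   is thus a multiple of the disjointness matrix of pairs in an (n+1)-set, which is invertible.
   Hence there are curves of simplices whose face volumes leave the regular simplex in any
   prescribed direction u. Along them the lowest nonzero homogeneous part of P at that point
   would have to vanish at every u, so P = 0. *)

theory Submission
  imports Defs "HOL-Computational_Algebra.Polynomial"
begin

section \<open>Polynomials vanishing along curves\<close>

text \<open>The volumes contain square roots, so \<open>P\<close> is not tested against polynomial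
  identities in the coordinates: it is tested along one-parameter families of simplices, where only
  the value and the first derivative at the regular simplex have to be known. The vertices move
  along straight lines, and the centred regular simplex makes it easy to reach every variation of
  the edges: its Gram matrix is the identity minus a multiple of the all-ones matrix, so pairing
  with differences of vertices reads off coefficients. All edges of a regular face contribute
  equally to the derivative of its volume by symmetry; the cofactors of the Gram matrix supply the
  constant. A face opposite to the pair {a,b} contains exactly the edges disjoint from {a,b}, whence
  the disjointness matrix. For n = 2 no two pairs are disjoint and this matrix is zero; for n \<ge>
  3 the divisors n - 2 and n - 1 in its inverse are nonzero.\<close>

lemma monomials_independent:
  fixes e :: "'m \<Rightarrow> 'v \<Rightarrow> nat" and c :: "'m \<Rightarrow> complex"
  assumes "finite V" "finite K"
    and "\<And>m m'. m \<in> K \<Longrightarrow> m' \<in> K \<Longrightarrow> (\<And>y. y \<in> V \<Longrightarrow> e m y = e m' y) \<Longrightarrow> m = m'"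
    and "\<And>x :: 'v \<Rightarrow> real. (\<Sum>m\<in>K. c m * (\<Prod>y\<in>V. of_real (x y) ^ e m y)) = 0"
    and "m \<in> K"
  shows "c m = 0"
  using assms
proof (induction V arbitrary: K m rule: finite_induct)
  case empty
  then have "K = {m}" by auto
  with empty show ?case by simp
next
  case (insert a V)
  \<comment> \<open>With the other variables frozen, the sum is a univariate polynomial in the
    variable \<open>a\<close> with infinitely many roots. Its coefficient at \<open>e m a\<close>
    collects exactly the monomials of \<open>L\<close>, which differ outside
    \<open>a\<close>.\<close>
  define L where "L = {l \<in> K. e l a = e m a}"
  show ?case
  proof (rule insert.IH)
    show "finite L" "m \<in> L" using insert.prems by (auto simp: L_def)
    show "l = l'" if "l \<in> L" "l' \<in> L" "\<And>y. y \<in> V \<Longrightarrow> e l y = e l' y" for l l'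
      using that by (intro insert.prems(2)) (auto simp: L_def)
    fix x :: "'v \<Rightarrow> real"
    define w where "w l = c l * (\<Prod>y\<in>V. of_real (x y) ^ e l y)" for l
    define p where "p = (\<Sum>l\<in>K. Polynomial.monom (w l) (e l a))"
    have "poly p (of_real t) = 0" for t :: real
    proof -
      have "(\<Prod>y\<in>V. of_real ((x(a := t)) y) ^ e l y) = (\<Prod>y\<in>V. complex_of_real (x y) ^ e l y)" for l
        using insert.hyps by (intro prod.cong) auto
      then show ?thesis using insert.prems(3)[of "x(a := t)"] insert.hyps
        by (simp add: p_def w_def poly_sum poly_monom mult_ac)
    qed
    then have "range complex_of_real \<subseteq> {z. poly p z = 0}" by auto
    moreover have "infinite (range complex_of_real)"
      using finite_imageD[OF _ inj_of_real] infinite_UNIV_char_0 by blast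
    ultimately have "p = 0" using poly_roots_finite finite_subset by metis
    then have "0 = coeff p (e m a)" by simp
    also have "\<dots> = (\<Sum>l\<in>K. if e l a = e m a then w l else 0)"
      by (simp add: p_def coeff_sum)
    also have "\<dots> = (\<Sum>l\<in>L. w l)"
      using insert.prems(1) unfolding L_def by (simp add: sum.inter_filter)
    finally show "(\<Sum>l\<in>L. c l * (\<Prod>y\<in>V. of_real (x y) ^ e l y)) = 0" by (simp add: w_def)
  qed
qed

lemma mpoly_eq_0I:
  fixes P :: "('v \<Rightarrow>\<^sub>0 nat) \<Rightarrow>\<^sub>0 complex"
  assumes "\<And>x :: 'v \<Rightarrow> real. mpoly_eval P (\<lambda>y. of_real (x y)) = 0"
  shows "P = 0"
proof (rule poly_mapping_eqI)
  fix m
  have V: "finite (mpoly_vars P)" by (simp add: mpoly_vars_def)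
  have "Poly_Mapping.lookup P m = 0" if "m \<in> Poly_Mapping.keys P"
  proof (rule monomials_independent[OF V finite_keys _ _ that, where e = Poly_Mapping.lookup])
    fix m m' assume mem: "m \<in> Poly_Mapping.keys P" "m' \<in> Poly_Mapping.keys P"
      and eq: "\<And>y. y \<in> mpoly_vars P \<Longrightarrow> Poly_Mapping.lookup m y = Poly_Mapping.lookup m' y"
    show "m = m'"
    proof (rule poly_mapping_eqI)
      fix y show "Poly_Mapping.lookup m y = Poly_Mapping.lookup m' y"
        using mem eq[of y] by (cases "y \<in> mpoly_vars P") (auto simp: mpoly_vars_def in_keys_iff)
    qed
  next
    fix x :: "'v \<Rightarrow> real"
    have "(\<Prod>y\<in>mpoly_vars P. complex_of_real (x y) ^ Poly_Mapping.lookup m y)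
        = (\<Prod>y\<in>Poly_Mapping.keys m. complex_of_real (x y) ^ Poly_Mapping.lookup m y)"
      if "m \<in> Poly_Mapping.keys P" for m
      using that V by (intro prod.mono_neutral_right) (auto simp: mpoly_vars_def in_keys_iff)
    then show "(\<Sum>m\<in>Poly_Mapping.keys P. Poly_Mapping.lookup P m *
        (\<Prod>y\<in>mpoly_vars P. of_real (x y) ^ Poly_Mapping.lookup m y)) = 0"
      using assms[of x] by (simp add: mpoly_eval_def)
  qed
  then show "Poly_Mapping.lookup P m = Poly_Mapping.lookup 0 m"
    by (auto simp: in_keys_iff)
qed

text \<open>The restriction of \<open>P\<close> to the line through \<open>x\<close> in direction
  \<open>w\<close>. Its coefficient of degree d is the degree-d part of the Taylor expansion of
  \<open>P\<close> at \<open>x\<close>, evaluated at \<open>w\<close>; homogeneous parts are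
  accessed only in this way.\<close>

definition mpoly_on_line ::
  "(('v \<Rightarrow>\<^sub>0 nat) \<Rightarrow>\<^sub>0 complex) \<Rightarrow> ('v \<Rightarrow> complex) \<Rightarrow> ('v \<Rightarrow> complex) \<Rightarrow> complex poly" where
  "mpoly_on_line P x w = (\<Sum>m\<in>Poly_Mapping.keys P.
     smult (Poly_Mapping.lookup P m) (\<Prod>y\<in>Poly_Mapping.keys m. [:x y, w y:] ^ Poly_Mapping.lookup m y))"

lemma poly_mpoly_on_line: "poly (mpoly_on_line P x w) s = mpoly_eval P (\<lambda>y. x y + s * w y)"
  by (simp add: mpoly_on_line_def mpoly_eval_def poly_sum poly_prod)

text \<open>The point of this crude bound is that it does not depend on \<open>x\<close> or
  \<open>w\<close>.\<close>

lemma degree_mpoly_on_line: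
  "degree (mpoly_on_line P x w) \<le> (\<Sum>m\<in>Poly_Mapping.keys P. \<Sum>y\<in>Poly_Mapping.keys m. Poly_Mapping.lookup m y)"
proof -
  have "degree (smult (Poly_Mapping.lookup P m) (\<Prod>y\<in>Poly_Mapping.keys m. [:x y, w y:] ^ Poly_Mapping.lookup m y))
      \<le> (\<Sum>m\<in>Poly_Mapping.keys P. \<Sum>y\<in>Poly_Mapping.keys m. Poly_Mapping.lookup m y)"
    if m: "m \<in> Poly_Mapping.keys P" for m
  proof -
    have "degree (smult (Poly_Mapping.lookup P m) (\<Prod>y\<in>Poly_Mapping.keys m. [:x y, w y:] ^ Poly_Mapping.lookup m y))
        \<le> degree (\<Prod>y\<in>Poly_Mapping.keys m. [:x y, w y:] ^ Poly_Mapping.lookup m y)"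
      by (rule degree_smult_le)
    also have "\<dots> \<le> (\<Sum>y\<in>Poly_Mapping.keys m. degree ([:x y, w y:] ^ Poly_Mapping.lookup m y))"
      using degree_prod_sum_le[OF finite_keys] by (simp add: o_def)
    also have "\<dots> \<le> (\<Sum>y\<in>Poly_Mapping.keys m. Poly_Mapping.lookup m y)"
      by (intro sum_mono order_trans[OF degree_power_le]) simp
    also have "\<dots> \<le> (\<Sum>m\<in>Poly_Mapping.keys P. \<Sum>y\<in>Poly_Mapping.keys m. Poly_Mapping.lookup m y)"
      by (rule member_le_sum[OF m]) auto
    finally show ?thesis .
  qed
  then show ?thesis unfolding mpoly_on_line_def by (intro degree_sum_le) auto
qed

lemma tendsto_coeff_mult:
  fixes p q :: "'a \<Rightarrow> 'b::real_normed_field poly"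
  assumes "\<And>d. ((\<lambda>t. coeff (p t) d) \<longlongrightarrow> coeff p' d) F" "\<And>d. ((\<lambda>t. coeff (q t) d) \<longlongrightarrow> coeff q' d) F"
  shows "((\<lambda>t. coeff (p t * q t) d) \<longlongrightarrow> coeff (p' * q') d) F"
  unfolding coeff_mult by (intro tendsto_intros assms)

lemma tendsto_coeff_power:
  fixes p :: "'a \<Rightarrow> 'b::real_normed_field poly"
  assumes "\<And>d. ((\<lambda>t. coeff (p t) d) \<longlongrightarrow> coeff p' d) F"
  shows "((\<lambda>t. coeff (p t ^ k) d) \<longlongrightarrow> coeff (p' ^ k) d) F"
  by (induction k arbitrary: d) (auto intro: tendsto_coeff_mult assms)

lemma tendsto_coeff_prod:
  fixes p :: "'c \<Rightarrow> 'a \<Rightarrow> 'b::real_normed_field poly"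
  assumes "\<And>y d. y \<in> A \<Longrightarrow> ((\<lambda>t. coeff (p y t) d) \<longlongrightarrow> coeff (p' y) d) F"
  shows "((\<lambda>t. coeff (\<Prod>y\<in>A. p y t) d) \<longlongrightarrow> coeff (\<Prod>y\<in>A. p' y) d) F"
  using assms
  by (induction A arbitrary: d rule: infinite_finite_induct) (auto intro: tendsto_coeff_mult)

text \<open>Each coefficient is a polynomial expression in the direction, hence continuous in
  it.\<close>

lemma tendsto_coeff_mpoly_on_line:
  assumes "\<And>y. y \<in> mpoly_vars P \<Longrightarrow> ((\<lambda>t. w t y) \<longlongrightarrow> u y) F"
  shows "((\<lambda>t. coeff (mpoly_on_line P x (w t)) d) \<longlongrightarrow> coeff (mpoly_on_line P x u) d) F"
  unfolding mpoly_on_line_def coeff_sum coeff_smult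
proof (intro tendsto_sum tendsto_mult tendsto_const tendsto_coeff_prod tendsto_coeff_power)
  fix m y d assume "m \<in> Poly_Mapping.keys P" "y \<in> Poly_Mapping.keys m"
  then have "((\<lambda>t. w t y) \<longlongrightarrow> u y) F" using assms by (auto simp: mpoly_vars_def)
  then show "((\<lambda>t. coeff [:x y, w t y:] d) \<longlongrightarrow> coeff [:x y, u y:] d) F"
    by (auto simp: coeff_pCons split: nat.split)
qed

text \<open>The lowest nonvanishing homogeneous part of \<open>P\<close> at \<open>x\<close> would survive on a curve through \<open>x\<close>
  in a generic direction; so first order contact with every direction is enough.\<close>

lemma mpoly_eq_0_of_curves:
  fixes P :: "('v \<Rightarrow>\<^sub>0 nat) \<Rightarrow>\<^sub>0 complex" and x :: "'v \<Rightarrow> real"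
  assumes curves: "\<And>u :: 'v \<Rightarrow> real. \<exists>w :: real \<Rightarrow> 'v \<Rightarrow> real.
      (\<forall>y\<in>mpoly_vars P. ((\<lambda>t. w t y) \<longlongrightarrow> u y) (at_right 0)) \<and>
      (\<forall>\<^sub>F t in at_right 0. mpoly_eval P (\<lambda>y. of_real (x y + t * w t y)) = 0)"
  shows "P = 0"
proof (rule mpoly_eq_0I)
  define q where "q u = mpoly_on_line P (\<lambda>y. of_real (x y)) (\<lambda>y. of_real (u y))" for u :: "'v \<Rightarrow> real"
  define D where "D = (\<Sum>m\<in>Poly_Mapping.keys P. \<Sum>y\<in>Poly_Mapping.keys m. Poly_Mapping.lookup m y)"
  have D: "degree (q u) \<le> D" for u
    unfolding q_def D_def by (rule degree_mpoly_on_line)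
  \<comment> \<open>The induction treats all directions at once, since the coefficients below d must
    vanish at the moving direction \<open>w t\<close> and not only at its limit \<open>u\<close>.
    What remains can be divided by \<open>t ^ d\<close> before t tends to 0.\<close>
  have coeff0: "coeff (q u) d = 0" for u d
  proof (induction d arbitrary: u rule: less_induct)
    case (less d)
    show ?case
    proof (cases "d \<le> D")
      case False
      then show ?thesis using D[of u] by (simp add: coeff_eq_0)
    next
      case True
      obtain w where w: "\<And>y. y \<in> mpoly_vars P \<Longrightarrow> ((\<lambda>t. w t y) \<longlongrightarrow> u y) (at_right 0)"
        and ev: "\<forall>\<^sub>F t in at_right 0. mpoly_eval P (\<lambda>y. of_real (x y + t * w t y)) = 0"
        using curves by blast
      have ev0: "\<forall>\<^sub>F t in at_right 0. (\<Sum>e=d..D. coeff (q (w t)) e * of_real t ^ (e - d)) = 0"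
        using ev eventually_at_right_less[of 0]
      proof eventually_elim
        case (elim t)
        have "0 = poly (q (w t)) (of_real t)"
          using elim by (simp add: q_def poly_mpoly_on_line)
        also have "\<dots> = (\<Sum>e\<le>D. coeff (q (w t)) e * of_real t ^ e)"
          unfolding poly_altdef using D[of "w t"] by (intro sum.mono_neutral_left) (auto simp: coeff_eq_0)
        also have "\<dots> = (\<Sum>e=d..D. coeff (q (w t)) e * of_real t ^ e)"
          using less.IH by (intro sum.mono_neutral_right) auto
        also have "\<dots> = of_real t ^ d * (\<Sum>e=d..D. coeff (q (w t)) e * of_real t ^ (e - d))"
          unfolding sum_distrib_left
          by (intro sum.cong refl) (auto simp: power_add[symmetric])
        finally show ?case using elim by simp
      qed
      \<comment> \<open>The range of summation ends at the uniform bound \<open>D\<close>, so the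
        limit can be taken term by term. Since \<open>0 ^ 0 = 1\<close>, the term
        \<open>e = d\<close> survives it.\<close>
      have lim: "((\<lambda>t. \<Sum>e=d..D. coeff (q (w t)) e * of_real t ^ (e - d)) \<longlongrightarrow>
          (\<Sum>e=d..D. coeff (q u) e * of_real 0 ^ (e - d))) (at_right 0)"
        unfolding q_def
        by (intro tendsto_intros tendsto_coeff_mpoly_on_line w)
      have "(\<Sum>e=d..D. coeff (q u) e * of_real 0 ^ (e - d)) = 0"
        by (rule tendsto_unique[OF _ lim tendsto_eventually[OF ev0]]) simp
      moreover have "(\<Sum>e=d..D. coeff (q u) e * of_real 0 ^ (e - d)) = (\<Sum>e=d..D. if e = d then coeff (q u) e else 0)"
        by (intro sum.cong) (auto simp: power_0_left)
      ultimately show ?thesis using True by simp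
    qed
  qed
  fix z :: "'v \<Rightarrow> real"
  have "mpoly_eval P (\<lambda>y. of_real (z y)) = poly (q (\<lambda>y. z y - x y)) 1"
    by (simp add: q_def poly_mpoly_on_line)
  also have "q (\<lambda>y. z y - x y) = 0" using coeff0 by (simp add: poly_eq_iff)
  finally show "mpoly_eval P (\<lambda>y. of_real (z y)) = 0" by simp
qed

section \<open>Leibniz determinants and their derivative\<close>

definition leibniz_det :: "'i set \<Rightarrow> ('i \<Rightarrow> 'i \<Rightarrow> real) \<Rightarrow> real" where
  "leibniz_det S A = (\<Sum>p | p permutes S. of_int (sign p) * (\<Prod>i\<in>S. A i (p i)))"

text \<open>The signed cofactor, obtained by selecting the permutations that send \<open>i\<close>
  to \<open>j\<close> instead of deleting a row and a column. The index set needs no renumbering and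
  the sign is already right.\<close>

definition leibniz_cofactor :: "'i set \<Rightarrow> ('i \<Rightarrow> 'i \<Rightarrow> real) \<Rightarrow> 'i \<Rightarrow> 'i \<Rightarrow> real" where
  "leibniz_cofactor S A i j =
     (\<Sum>p | p permutes S. of_int (sign p) * (of_bool (p i = j) * (\<Prod>l\<in>S - {i}. A l (p l))))"

text \<open>The new row \<open>r\<close> is arbitrary because two choices matter later: another row
  of \<open>A\<close>, for the product of the cofactor matrix with \<open>A\<close>, and the
  derivative of row \<open>i\<close>, for differentiating the determinant.\<close>

lemma leibniz_det_row_expansion:
  assumes "finite S" "i \<in> S"
  shows "(\<Sum>j\<in>S. leibniz_cofactor S A i j * r j) = leibniz_det S (A(i := r))"
proof -
  have "(\<Sum>j\<in>S. leibniz_cofactor S A i j * r j) =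
      (\<Sum>p | p permutes S. \<Sum>j\<in>S. of_int (sign p) * (of_bool (p i = j) * (\<Prod>l\<in>S - {i}. A l (p l))) * r j)"
    unfolding leibniz_cofactor_def sum_distrib_right by (rule sum.swap)
  also have "\<dots> = (\<Sum>p | p permutes S. of_int (sign p) * (\<Prod>l\<in>S. (A(i := r)) l (p l)))"
  proof (rule sum.cong[OF refl])
    fix p assume "p \<in> {p. p permutes S}"
    then have pi: "p i \<in> S" using assms permutes_in_image by fastforce
    have "(\<Sum>j\<in>S. of_int (sign p) * (of_bool (p i = j) * (\<Prod>l\<in>S - {i}. A l (p l))) * r j)
        = (\<Sum>j\<in>S. if j = p i then of_int (sign p) * ((\<Prod>l\<in>S - {i}. A l (p l)) * r j) else 0)"
      by (intro sum.cong) auto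
    also have "\<dots> = of_int (sign p) * ((\<Prod>l\<in>S - {i}. A l (p l)) * r (p i))"
      using pi assms by simp
    also have "(\<Prod>l\<in>S - {i}. A l (p l)) * r (p i) = (\<Prod>l\<in>S. (A(i := r)) l (p l))"
      using assms by (subst prod.remove[of S i]) (auto intro!: prod.cong)
    finally show "(\<Sum>j\<in>S. of_int (sign p) * (of_bool (p i = j) * (\<Prod>l\<in>S - {i}. A l (p l))) * r j)
        = of_int (sign p) * (\<Prod>l\<in>S. (A(i := r)) l (p l))" .
  qed
  finally show ?thesis unfolding leibniz_det_def .
qed

text \<open>Composing with the transposition of \<open>a\<close> and \<open>b\<close> flips every
  sign and, the two rows being equal, leaves every product unchanged; so the determinant is its own
  negative.\<close>

lemma leibniz_det_identical_rows:
  assumes "finite S" "a \<in> S" "b \<in> S" "a \<noteq> b" and eq: "A a = A b"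
  shows "leibniz_det S A = 0"
proof -
  let ?t = "Transposition.transpose a b"
  let ?f = "\<lambda>p. of_int (sign p) * (\<Prod>i\<in>S. A i (p i))"
  have tp: "?t permutes S" using assms by (simp add: permutes_swap_id)
  have "leibniz_det S A = (\<Sum>p | p permutes S. ?f (p \<circ> ?t))"
    unfolding leibniz_det_def by (rule sum_permutations_compose_right[OF tp])
  also have "\<dots> = (\<Sum>p | p permutes S. - ?f p)"
  proof (rule sum.cong[OF refl])
    fix p assume "p \<in> {p. p permutes S}"
    then have p: "p permutes S" by simp
    have "sign (p \<circ> ?t) = sign p * sign ?t"
      by (rule sign_compose) (use p tp assms permutation_permutes in blast)+
    moreover have "sign ?t = -1" using assms by (simp add: sign_swap_id)
    moreover have "(\<Prod>i\<in>S. A i ((p \<circ> ?t) i)) = (\<Prod>i\<in>S. A (?t i) (p (?t i)))"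
      by (rule prod.cong) (auto simp: Transposition.transpose_def eq)
    moreover have "\<dots> = (\<Prod>i\<in>S. A i (p i))"
      using prod.permute[OF tp, of "\<lambda>i. A i (p i)"] by (simp add: o_def)
    ultimately show "?f (p \<circ> ?t) = - ?f p" by simp
  qed
  also have "\<dots> = - leibniz_det S A" unfolding leibniz_det_def by (simp add: sum_negf)
  finally show ?thesis by simp
qed

lemma leibniz_cofactor_mult_row:
  assumes "finite S" "i \<in> S" "i' \<in> S"
  shows "(\<Sum>j\<in>S. leibniz_cofactor S A i j * A i' j) = (if i = i' then leibniz_det S A else 0)"
proof -
  have "leibniz_det S (A(i := A i')) = 0" if "i \<noteq> i'"
    by (rule leibniz_det_identical_rows[of S i i']) (use assms that in auto)
  then show ?thesis using leibniz_det_row_expansion[OF assms(1,2), of A "A i'"] by auto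
qed

text \<open>Jacobi's formula. The product rule gives one determinant per row, with that row replaced
  by its derivative; each is expanded along this row.\<close>

lemma has_real_derivative_leibniz_det:
  assumes S: "finite S"
    and A: "\<And>i j. i \<in> S \<Longrightarrow> j \<in> S \<Longrightarrow> ((\<lambda>t. A t i j) has_real_derivative H i j) (at x)"
  shows "((\<lambda>t. leibniz_det S (A t)) has_real_derivative
           (\<Sum>i\<in>S. \<Sum>j\<in>S. leibniz_cofactor S (A x) i j * H i j)) (at x)"
proof -
  have "((\<lambda>t. leibniz_det S (A t)) has_real_derivative
      (\<Sum>p | p permutes S. of_int (sign p) * (\<Sum>i\<in>S. H i (p i) * (\<Prod>l\<in>S - {i}. A x l (p l))))) (at x)"
    unfolding leibniz_det_def
    by (intro DERIV_sum DERIV_cmult has_field_derivative_prod A) (auto simp: permutes_in_image)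
  also have "(\<Sum>p | p permutes S. of_int (sign p) * (\<Sum>i\<in>S. H i (p i) * (\<Prod>l\<in>S - {i}. A x l (p l))))
      = (\<Sum>i\<in>S. \<Sum>p | p permutes S. of_int (sign p) * (H i (p i) * (\<Prod>l\<in>S - {i}. A x l (p l))))"
    unfolding sum_distrib_left by (rule sum.swap)
  also have "\<dots> = (\<Sum>i\<in>S. leibniz_det S ((A x)(i := H i)))"
    unfolding leibniz_det_def
  proof (intro sum.cong refl arg_cong2[where f = "(*)"])
    fix i p assume "i \<in> S"
    then show "H i (p i) * (\<Prod>l\<in>S - {i}. A x l (p l)) = (\<Prod>l\<in>S. ((A x)(i := H i)) l (p l))"
      by (subst prod.remove[OF S \<open>i \<in> S\<close>]) (auto intro!: prod.cong)
  qed
  also have "\<dots> = (\<Sum>i\<in>S. \<Sum>j\<in>S. leibniz_cofactor S (A x) i j * H i j)"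
    using leibniz_det_row_expansion[OF S] by (intro sum.cong) auto
  finally show ?thesis .
qed

text \<open>Gram matrix of the edge vectors leaving one vertex of a regular simplex whose edges have
  squared length 2.\<close>

abbreviation regular_gram :: "'i \<Rightarrow> 'i \<Rightarrow> real" where
  "regular_gram \<equiv> \<lambda>i j. 1 + of_bool (i = j)"

text \<open>The cofactor matrix is read off from \<open>C M = det M\<close>: row sums of \<open>C\<close> determine everything.\<close>

lemma leibniz_cofactor_regular_gram:
  assumes "finite S" "i \<in> S" "j \<in> S"
  shows "leibniz_cofactor S regular_gram i j =
           leibniz_det S regular_gram * (of_bool (i = j) - 1 / (real (card S) + 1))"
proof -
  let ?C = "leibniz_cofactor S regular_gram" and ?D = "leibniz_det S regular_gram"
  define \<sigma> where "\<sigma> = (\<Sum>j\<in>S. ?C i j)"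
  have C: "?C i l = ?D * of_bool (i = l) - \<sigma>" if "l \<in> S" for l
  proof -
    have "(\<Sum>j\<in>S. ?C i j * (1 + of_bool (l = j))) = \<sigma> + (\<Sum>j\<in>S. if j = l then ?C i j else 0)"
      unfolding \<sigma>_def sum.distrib[symmetric] by (intro sum.cong) auto
    also have "\<dots> = \<sigma> + ?C i l" using that assms by simp
    finally show ?thesis using leibniz_cofactor_mult_row[OF assms(1,2) that, of regular_gram] by auto
  qed
  \<comment> \<open>Summing the formula for row \<open>i\<close> over its entries gives a linear
    equation for the row sum itself.\<close>
  have "\<sigma> = (\<Sum>l\<in>S. (if l = i then ?D else 0) - \<sigma>)"
    unfolding \<sigma>_def using C by (intro sum.cong) (auto simp: \<sigma>_def)
  also have "\<dots> = ?D - card S * \<sigma>" using assms by (simp add: sum_subtractf)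
  finally have "\<sigma> = ?D / (real (card S) + 1)" by (simp add: field_simps add_eq_0_iff)
  then show ?thesis using C[OF assms(3)] by (simp add: algebra_simps)
qed

text \<open>The permutations of \<open>S\<close> that fix \<open>i\<close> are the permutations of
  \<open>S - {i}\<close>.\<close>

lemma leibniz_cofactor_diag:
  assumes "finite S" "i \<in> S"
  shows "leibniz_cofactor S A i i = leibniz_det (S - {i}) A"
proof -
  have "{p. p permutes S - {i}} \<subseteq> {p. p permutes S}"
    by (auto intro: permutes_subset)
  moreover have "p permutes S - {i}" if "p permutes S" "p i = i" for p
    using that by (auto intro!: permutes_superset[where S = S])
  moreover have "p i = i" if "p permutes S - {i}" for p
    using that by (simp add: permutes_not_in)
  ultimately have "leibniz_cofactor S A i i =
      (\<Sum>p | p permutes S - {i}. of_int (sign p) * (of_bool (p i = i) * (\<Prod>l\<in>S - {i}. A l (p l))))"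
    unfolding leibniz_cofactor_def using assms
    by (intro sum.mono_neutral_right) (auto simp: finite_permutations)
  then show ?thesis unfolding leibniz_det_def by (simp add: permutes_not_in)
qed

text \<open>The cofactor formula is relative to the unknown determinant. At a diagonal entry the
  cofactor is the next smaller determinant, so the formula becomes a ratio of consecutive
  determinants, (k+1)/(k+2), and induction applies.\<close>

lemma leibniz_det_regular_gram:
  "finite S \<Longrightarrow> leibniz_det S regular_gram = real (card S) + 1"
proof (induction S rule: finite_induct)
  case empty
  then show ?case by (simp add: leibniz_det_def sign_id)
next
  case (insert i S)
  have "leibniz_det S regular_gram = leibniz_cofactor (insert i S) regular_gram i i"
    using insert by (subst leibniz_cofactor_diag) auto
  also have "\<dots> = leibniz_det (insert i S) regular_gram * (1 - 1 / (real (card S) + 2))"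
    using insert by (subst leibniz_cofactor_regular_gram) (auto simp: add_ac)
  finally have "leibniz_det (insert i S) regular_gram * (real (card S) + 1) = (real (card S) + 2) * (real (card S) + 1)"
    using insert by (simp add: field_simps)
  then show ?case using insert by (simp add: add_ac)
qed

section \<open>Perturbations of the regular simplex\<close>

text \<open>The prescribed Gram matrix is that of the standard basis of (n+1)-space projected along
  the all-ones vector; here it is realised in only n coordinates.\<close>

lemma exists_regular_simplex:
  assumes n: "n = CARD('n::finite)"
  obtains b :: "nat \<Rightarrow> real ^ 'n"
  where "\<And>i j. i \<le> n \<Longrightarrow> j \<le> n \<Longrightarrow> b i \<bullet> b j = of_bool (i = j) - 1 / (real n + 1)"
proof -
  obtain g :: "'n \<Rightarrow> nat" where g: "bij_betw g UNIV {..<n}"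
    using ex_bij_betw_finite_nat[of "UNIV :: 'n set"] n by (auto simp: atLeast0LessThan)
  have n0: "n > 0" using n by simp
  \<comment> \<open>The last vertex is -r(1,...,1), and n r^2 = 1 - 1/(n+1) fixes r. The others are
    unit vectors minus a(1,...,1), and a is chosen to put the centroid at 0, that is 1 - n a - r =
    0.\<close>
  define r where "r = 1 / sqrt (real n + 1)"
  have r2: "r * r = 1 / (real n + 1)" by (simp add: r_def)
  define a where "a = (1 - r) / real n"
  have na: "real n * a = 1 - r" using n0 by (simp add: a_def)
  have "real n * (real n * a\<^sup>2 - 2 * a) = (real n * a)\<^sup>2 - 2 * (real n * a)"
    by (simp add: power2_eq_square algebra_simps)
  also have "\<dots> = r * r - 1" unfolding na by (simp add: power2_eq_square algebra_simps)
  also have "\<dots> = - (real n * (1 / (real n + 1)))" unfolding r2 by (simp add: field_simps)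
  finally have "real n * (real n * a\<^sup>2 - 2 * a + 1 / (real n + 1)) = 0" by (simp add: algebra_simps)
  then have aa: "real n * a\<^sup>2 - 2 * a = - 1 / (real n + 1)" using n0 by simp
  define b :: "nat \<Rightarrow> real ^ 'n"
    where "b k = (\<chi> i. if k < n then of_bool (g i = k) - a else - r)" for k
  have inner_b: "b i \<bullet> b j = (\<Sum>k<n. (if i < n then of_bool (k = i) - a else - r) *
      (if j < n then of_bool (k = j) - a else - r))" for i j
    unfolding inner_vec_def b_def
    using sum.reindex_bij_betw[OF g, of "\<lambda>k. (if i < n then of_bool (k = i) - a else - r) *
      (if j < n then of_bool (k = j) - a else - r)"] by simp
  have lt: "b i \<bullet> b j = of_bool (i = j) - 1 / (real n + 1)" if "i < n" "j < n" for i j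
  proof -
    have "b i \<bullet> b j = (\<Sum>k<n. (if k = i then of_bool (i = j) else 0) - (if k = i then a else 0)
        - (if k = j then a else 0) + a\<^sup>2)"
      unfolding inner_b using that
      by (intro sum.cong) (auto simp: algebra_simps power2_eq_square)
    also have "\<dots> = of_bool (i = j) + (real n * a\<^sup>2 - 2 * a)"
      using that by (simp add: sum.distrib sum_subtractf)
    finally show ?thesis unfolding aa by simp
  qed
  have eq: "b i \<bullet> b n = - 1 / (real n + 1)" if "i < n" for i
  proof -
    have "b i \<bullet> b n = (\<Sum>k<n. (if k = i then - r else 0) + a * r)"
      unfolding inner_b using that by (intro sum.cong) (auto simp: algebra_simps)
    also have "\<dots> = - r * (1 - real n * a)"
      using that by (simp add: sum.distrib algebra_simps)
    also have "\<dots> = - (r * r)" unfolding na by simp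
    finally show ?thesis unfolding r2 by simp
  qed
  have nn: "b n \<bullet> b n = 1 - 1 / (real n + 1)"
  proof -
    have "b n \<bullet> b n = real n * (r * r)" unfolding inner_b by simp
    then show ?thesis unfolding r2 by (simp add: field_simps)
  qed
  show thesis
  proof (rule that)
    fix i j assume ij: "i \<le> n" "j \<le> n"
    show "b i \<bullet> b j = of_bool (i = j) - 1 / (real n + 1)"
    proof (cases "i < n")
      case True
      then show ?thesis using ij lt[of i j] eq[of i] by (cases "j = n") auto
    next
      case False
      then have "i = n" using ij by simp
      then show ?thesis using ij nn eq[of j] by (cases "j = n") (auto simp: inner_commute[of "b n" "b j"])
    qed
  qed
qed

lemma nondeg_simplexI:
  fixes v :: "nat \<Rightarrow> real ^ 'n"
  assumes indep: "\<And>c k. (\<Sum>k\<le>CARD('n). c k) = 0 \<Longrightarrow> (\<Sum>k\<le>CARD('n). c k *\<^sub>R v k) = 0 \<Longrightarrow>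
      k \<le> CARD('n) \<Longrightarrow> c k = 0"
  shows "nondeg_simplex v"
proof -
  let ?N = "{..CARD('n)}"
  have inj: "inj_on v ?N"
  proof (rule inj_onI, rule ccontr)
    fix i j assume ij: "i \<in> ?N" "j \<in> ?N" "v i = v j" "i \<noteq> j"
    let ?c = "\<lambda>k. (if k = i then 1 else 0) - (if k = j then 1 else 0 :: real)"
    have "(\<Sum>k\<in>?N. ?c k *\<^sub>R v k) = (\<Sum>k\<in>?N. (if k = i then v k else 0) - (if k = j then v k else 0))"
      by (intro sum.cong) auto
    also have "\<dots> = 0" using ij by (simp add: sum_subtractf)
    finally have cv: "(\<Sum>k\<in>?N. ?c k *\<^sub>R v k) = 0" .
    have "(\<Sum>k\<in>?N. ?c k) = 0" using ij by (simp add: sum_subtractf)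
    from indep[OF this cv, of i] show False using ij by simp
  qed
  have "\<not> affine_dependent (v ` ?N)"
  proof
    assume "affine_dependent (v ` ?N)"
    then obtain U where U: "sum U (v ` ?N) = 0" "(\<Sum>x\<in>v ` ?N. U x *\<^sub>R x) = 0" "\<exists>x\<in>v ` ?N. U x \<noteq> 0"
      using affine_dependent_explicit_finite[of "v ` ?N"] by auto
    have "U (v k) = 0" if "k \<in> ?N" for k
      using indep[of "\<lambda>k. U (v k)" k] that U(1,2) by (simp add: sum.reindex[OF inj])
    then show False using U(3) by auto
  qed
  then show ?thesis using inj by (simp add: nondeg_simplex_def atLeast0AtMost)
qed

locale perturbed_regular_simplex =
  fixes b :: "nat \<Rightarrow> real ^ 'n" and s :: "nat \<Rightarrow> nat \<Rightarrow> real" and n :: nat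
  assumes n: "n = CARD('n)"
    and b: "i \<le> n \<Longrightarrow> j \<le> n \<Longrightarrow> b i \<bullet> b j = of_bool (i = j) - 1 / (real n + 1)"
    and s_sym: "s i j = s j i"
    and s_diag: "s i i = 0"
begin

text \<open>Pairing with \<open>b i - b j\<close> returns \<open>s k i - s k j\<close>, since the
  constant part of the Gram matrix cancels. Hence the squared length of the edge ij starts to change
  at rate \<open>-4 * s i j\<close>: the weights \<open>s\<close> prescribe the edge
  variations.\<close>

definition velocity :: "nat \<Rightarrow> real ^ 'n" where
  "velocity k = (\<Sum>j\<le>n. s k j *\<^sub>R b j)"

definition vertex :: "real \<Rightarrow> nat \<Rightarrow> real ^ 'n" where
  "vertex t k = b k + t *\<^sub>R velocity k"

lemma inner_b_sum:
  assumes "i \<le> n"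
  shows "b i \<bullet> (\<Sum>j\<le>n. c j *\<^sub>R b j) = c i - (\<Sum>j\<le>n. c j) / (real n + 1)"
proof -
  have "b i \<bullet> (\<Sum>j\<le>n. c j *\<^sub>R b j) = (\<Sum>j\<le>n. (if j = i then c j else 0) - c j / (real n + 1))"
    unfolding inner_sum_right using assms by (intro sum.cong) (auto simp: b algebra_simps)
  then show ?thesis using assms by (simp add: sum_subtractf sum_divide_distrib)
qed

text \<open>A relation \<open>c\<close> among the moved vertices becomes the relation
  \<open>c + t h\<close> among the \<open>b j\<close>, and those admit only relations with constant
  coefficients. As \<open>c\<close> sums to 0, it equals t times the deviation of \<open>h\<close>
  from its mean, so for small t the sum of the absolute values of \<open>c\<close> is bounded by a
  smaller multiple of itself.\<close>

lemma nondeg_vertex: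
  assumes B: "\<And>i j. i \<le> n \<Longrightarrow> j \<le> n \<Longrightarrow> \<bar>s i j\<bar> \<le> B"
    and t: "t \<ge> 0" "2 * t * B * (real n + 1) < 1"
  shows "nondeg_simplex (vertex t)"
proof (rule nondeg_simplexI)
  fix c :: "nat \<Rightarrow> real" and k
  assume "(\<Sum>k\<le>CARD('n). c k) = 0" "(\<Sum>k\<le>CARD('n). c k *\<^sub>R vertex t k) = 0" and k: "k \<le> CARD('n)"
  then have c0: "(\<Sum>k\<le>n. c k) = 0" and cv: "(\<Sum>k\<le>n. c k *\<^sub>R vertex t k) = 0" using n by auto
  define h where "h j = (\<Sum>k\<le>n. c k * s k j)" for j
  define C where "C = (\<Sum>k\<le>n. \<bar>c k\<bar>)"
  have h: "\<bar>h j\<bar> \<le> B * C" if "j \<le> n" for j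
  proof -
    have "\<bar>h j\<bar> \<le> (\<Sum>k\<le>n. \<bar>c k * s k j\<bar>)" unfolding h_def by (rule sum_abs)
    also have "\<dots> \<le> (\<Sum>k\<le>n. \<bar>c k\<bar> * B)"
      unfolding abs_mult using B that by (intro sum_mono mult_left_mono) auto
    finally show ?thesis by (simp add: C_def sum_distrib_left mult_ac)
  qed
  have "(\<Sum>k\<le>n. c k *\<^sub>R vertex t k) = (\<Sum>k\<le>n. c k *\<^sub>R b k) + (\<Sum>k\<le>n. \<Sum>j\<le>n. (t * (c k * s k j)) *\<^sub>R b j)"
    by (simp add: vertex_def velocity_def scaleR_add_right sum.distrib scaleR_sum_right mult_ac)
  also have "(\<Sum>k\<le>n. \<Sum>j\<le>n. (t * (c k * s k j)) *\<^sub>R b j) = (\<Sum>j\<le>n. (t * h j) *\<^sub>R b j)"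
    unfolding h_def sum_distrib_left scaleR_sum_left by (rule sum.swap)
  finally have rel: "(\<Sum>j\<le>n. (c j + t * h j) *\<^sub>R b j) = 0"
    using cv by (simp add: scaleR_add_left sum.distrib)
  define m where "m = (\<Sum>j\<le>n. h j) / (real n + 1)"
  have m: "\<bar>m\<bar> \<le> B * C"
  proof -
    have "\<bar>\<Sum>j\<le>n. h j\<bar> \<le> (\<Sum>j\<le>n. \<bar>h j\<bar>)" by (rule sum_abs)
    also have "\<dots> \<le> (\<Sum>j\<le>n. B * C)" using h by (intro sum_mono) auto
    finally show ?thesis by (simp add: m_def abs_divide field_simps)
  qed
  have c: "\<bar>c j\<bar> \<le> 2 * t * B * C" if "j \<le> n" for j
  proof -
    have "c j + t * h j - (\<Sum>j\<le>n. c j + t * h j) / (real n + 1) = 0"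
      using inner_b_sum[OF that, of "\<lambda>j. c j + t * h j"] rel by simp
    then have "c j = t * (m - h j)"
      by (simp add: sum.distrib c0 sum_distrib_left[symmetric] m_def algebra_simps)
    moreover have "\<bar>m - h j\<bar> \<le> 2 * (B * C)" using m h[OF that] by linarith
    ultimately show ?thesis using t mult_left_mono[of "\<bar>m - h j\<bar>" "2 * (B * C)" t]
      by (simp add: abs_mult mult_ac)
  qed
  have "C \<le> (\<Sum>j\<le>n. 2 * t * B * C)" unfolding C_def using c[unfolded C_def] by (intro sum_mono) auto
  then have "C * (1 - 2 * t * B * (real n + 1)) \<le> 0" by (simp add: algebra_simps)
  then have "C \<le> 0" using t by (simp add: mult_le_0_iff)
  moreover have "\<bar>c k\<bar> \<le> C" unfolding C_def using k n by (intro member_le_sum) auto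
  ultimately show "c k = 0" by simp
qed

lemma eventually_nondeg_vertex: "\<forall>\<^sub>F t in at_right 0. nondeg_simplex (vertex t)"
proof -
  define B where "B = (\<Sum>i\<le>n. \<Sum>j\<le>n. \<bar>s i j\<bar>)"
  have B: "\<bar>s i j\<bar> \<le> B" if "i \<le> n" "j \<le> n" for i j
  proof -
    have "\<bar>s i j\<bar> \<le> (\<Sum>j\<le>n. \<bar>s i j\<bar>)" using that by (intro member_le_sum) auto
    also have "\<dots> \<le> B" unfolding B_def using that
      by (intro member_le_sum[of i _ "\<lambda>i. \<Sum>j\<le>n. \<bar>s i j\<bar>"]) (auto intro: sum_nonneg)
    finally show ?thesis .
  qed
  have "((\<lambda>t. 2 * t * B * (real n + 1)) \<longlongrightarrow> 2 * 0 * B * (real n + 1)) (at_right 0)"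
    by (intro tendsto_intros)
  then have "\<forall>\<^sub>F t in at_right 0. 2 * t * B * (real n + 1) < 1"
    by (intro order_tendstoD(2)[of _ "2 * 0 * B * (real n + 1)"]) auto
  then show ?thesis using eventually_at_right_less[of 0]
    by eventually_elim (rule nondeg_vertex[OF B]; simp)
qed

lemma inner_diff_velocity:
  assumes "i \<le> n" "j \<le> n"
  shows "(b i - b j) \<bullet> velocity k = s k i - s k j"
  using assms by (simp add: inner_diff_left velocity_def inner_b_sum)

lemma gram_vertex_0:
  assumes "i \<le> n" "j \<le> n" "l \<le> n" "i \<noteq> l" "j \<noteq> l"
  shows "(vertex 0 i - vertex 0 l) \<bullet> (vertex 0 j - vertex 0 l) = regular_gram i j"
  using assms by (simp add: vertex_def inner_diff_left inner_diff_right b)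

lemma has_real_derivative_gram_vertex:
  assumes "i \<le> n" "j \<le> n" "l \<le> n"
  shows "((\<lambda>t. (vertex t i - vertex t l) \<bullet> (vertex t j - vertex t l)) has_real_derivative
           2 * (s i j - s l i - s l j)) (at 0)"
proof -
  let ?w = "\<lambda>i. velocity i - velocity l" and ?b = "\<lambda>i. b i - b l"
  have "(vertex t i - vertex t l) \<bullet> (vertex t j - vertex t l) =
      ?b i \<bullet> ?b j + t * (?b j \<bullet> ?w i + ?b i \<bullet> ?w j) + t\<^sup>2 * (?w i \<bullet> ?w j)" for t
  proof -
    have *: "vertex t k - vertex t l = ?b k + t *\<^sub>R ?w k" for k
      by (simp add: vertex_def algebra_simps)
    show ?thesis unfolding *
      by (simp only: inner_add_left inner_add_right inner_scaleR_left inner_scaleR_right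
            inner_commute[of "?w i" "?b j"]) (simp add: algebra_simps power2_eq_square)
  qed
  moreover have "((\<lambda>t. ?b i \<bullet> ?b j + t * (?b j \<bullet> ?w i + ?b i \<bullet> ?w j) + t\<^sup>2 * (?w i \<bullet> ?w j))
      has_real_derivative (?b j \<bullet> ?w i + ?b i \<bullet> ?w j)) (at 0)"
    by (auto intro!: derivative_eq_intros)
  moreover have "?b j \<bullet> ?w i + ?b i \<bullet> ?w j = 2 * (s i j - s l i - s l j)"
    using assms s_sym[of j i] s_sym[of i l] s_sym[of j l]
    by (simp add: inner_diff_right[of "?b j"] inner_diff_right[of "?b i"] inner_diff_velocity s_diag)
  ultimately show ?thesis by simp
qed

lemma
  assumes F: "F \<subseteq> {..n}" "F \<noteq> {}"
  shows face_volume_vertex_0: "face_volume (vertex 0) F = sqrt (card F) / fact (card F - 1)"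
    and has_real_derivative_face_volume:
      "((\<lambda>t. face_volume (vertex t) F) has_real_derivative
         - (\<Sum>i\<in>F. \<Sum>j\<in>F. s i j) / (sqrt (card F) * fact (card F - 1))) (at 0)"
proof -
  have finF: "finite F" using F finite_subset by blast
  define l where "l = Min F"
  define S where "S = F - {l}"
  have l: "l \<in> F" using finF F by (simp add: l_def)
  have S: "finite S" "l \<notin> S" "F = insert l S" using finF l by (auto simp: S_def)
  have cardS: "real (card F) = real (card S) + 1" "card S = card F - 1" using S by auto
  have le: "i \<le> n" if "i \<in> F" for i using F that by auto
  define A where "A t i j = (vertex t i - vertex t l) \<bullet> (vertex t j - vertex t l)" for t i j
  have fv: "face_volume (vertex t) F = sqrt (leibniz_det S (A t)) / fact (card F - 1)" for t
    by (simp add: face_volume_def gram_det_def leibniz_det_def A_def l_def[symmetric] S_def[symmetric]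
          cardS(2) Let_def)
  have A0: "A 0 i j = regular_gram i j" if "i \<in> S" "j \<in> S" for i j
    unfolding A_def using that S l by (intro gram_vertex_0 le) auto
  have "leibniz_det S (A 0) = leibniz_det S regular_gram"
    unfolding leibniz_det_def
    by (intro sum.cong refl arg_cong2[where f = "(*)"] prod.cong A0) (auto simp: permutes_in_image)
  then have det0: "leibniz_det S (A 0) = real (card F)"
    using leibniz_det_regular_gram[OF S(1)] cardS(1) by simp
  have cof0: "leibniz_cofactor S (A 0) i j = real (card F) * of_bool (i = j) - 1" if "i \<in> S" "j \<in> S" for i j
  proof -
    have "leibniz_cofactor S (A 0) i j = leibniz_cofactor S regular_gram i j"
      unfolding leibniz_cofactor_def
      by (intro sum.cong refl arg_cong2[where f = "(*)"] prod.cong A0) (auto simp: permutes_in_image)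
    then show ?thesis
      using leibniz_cofactor_regular_gram[OF S(1) that] leibniz_det_regular_gram[OF S(1)]
      by (simp add: cardS(1) right_diff_distrib)
  qed
  show "face_volume (vertex 0) F = sqrt (card F) / fact (card F - 1)"
    by (simp add: fv det0)
  define H where "H i j = 2 * (s i j - s l i - s l j)" for i j
  define \<rho> where "\<rho> = (\<Sum>i\<in>S. s l i)"
  define \<tau> where "\<tau> = (\<Sum>i\<in>S. \<Sum>j\<in>S. s i j)"
  \<comment> \<open>The Gram matrix singles out the base vertex \<open>l\<close>, so the edges at
    \<open>l\<close> (in \<open>\<rho>\<close>, each once) are kept apart from the others (in
    \<open>\<tau>\<close>, each twice).\<close>
  have total: "(\<Sum>i\<in>F. \<Sum>j\<in>F. s i j) = \<tau> + 2 * \<rho>"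
    using S s_sym[of _ l] by (simp add: sum.distrib \<tau>_def \<rho>_def s_diag)
  have "(\<Sum>i\<in>S. \<Sum>j\<in>S. leibniz_cofactor S (A 0) i j * H i j)
      = (\<Sum>i\<in>S. \<Sum>j\<in>S. (if j = i then real (card F) * H i j else 0) - H i j)"
    by (intro sum.cong) (auto simp: cof0 algebra_simps)
  also have "\<dots> = real (card F) * (\<Sum>i\<in>S. H i i) - (\<Sum>i\<in>S. \<Sum>j\<in>S. H i j)"
    using S(1) by (simp add: sum_subtractf sum_distrib_left)
  also have "(\<Sum>i\<in>S. H i i) = - 4 * \<rho>"
    unfolding \<rho>_def sum_distrib_left by (intro sum.cong) (auto simp: H_def s_diag)
  also have "(\<Sum>i\<in>S. \<Sum>j\<in>S. H i j) = 2 * (\<tau> - 2 * real (card S) * \<rho>)"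
    unfolding H_def sum_distrib_left[symmetric]
    by (simp add: sum_subtractf \<tau>_def[symmetric] \<rho>_def[symmetric] sum_distrib_left[symmetric])
  \<comment> \<open>With \<open>card F = card S + 1\<close> the multiples of \<open>card S\<close>
    cancel, and the edges at the base vertex get the same weight as all others.\<close>
  also have "real (card F) * (- 4 * \<rho>) - 2 * (\<tau> - 2 * real (card S) * \<rho>) = - 2 * (\<tau> + 2 * \<rho>)"
    unfolding cardS(1) by (simp add: algebra_simps)
  finally have sumH: "(\<Sum>i\<in>S. \<Sum>j\<in>S. leibniz_cofactor S (A 0) i j * H i j) = - 2 * (\<tau> + 2 * \<rho>)" .
  have "((\<lambda>t. leibniz_det S (A t)) has_real_derivative - 2 * (\<tau> + 2 * \<rho>)) (at 0)"
    unfolding sumH[symmetric]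
  proof (rule has_real_derivative_leibniz_det[OF S(1)])
    fix i j assume "i \<in> S" "j \<in> S"
    then show "((\<lambda>t. A t i j) has_real_derivative H i j) (at 0)"
      unfolding A_def H_def using S l by (intro has_real_derivative_gram_vertex le) auto
  qed
  note deriv = this
  have "leibniz_det S (A 0) > 0" unfolding det0 cardS by simp
  then have "((\<lambda>t. sqrt (leibniz_det S (A t))) has_real_derivative
      inverse (sqrt (leibniz_det S (A 0))) / 2 * (- 2 * (\<tau> + 2 * \<rho>))) (at 0)"
    by (rule DERIV_chain2[OF DERIV_real_sqrt deriv])
  then have "((\<lambda>t. sqrt (leibniz_det S (A t)) / fact (card F - 1)) has_real_derivative
      inverse (sqrt (leibniz_det S (A 0))) / 2 * (- 2 * (\<tau> + 2 * \<rho>)) / fact (card F - 1)) (at 0)"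
    by (rule DERIV_cdivide)
  moreover have "inverse x / 2 * (- 2 * z) / y = - z / (x * y)" for x y z :: real
    by (cases "x = 0"; cases "y = 0") (simp_all add: divide_simps)
  ultimately show "((\<lambda>t. face_volume (vertex t) F) has_real_derivative
         - (\<Sum>i\<in>F. \<Sum>j\<in>F. s i j) / (sqrt (card F) * fact (card F - 1))) (at 0)"
    by (simp only: fv total det0)
qed

end

text \<open>The disjointness matrix of pairs (the Kneser graph) is invertible; \<open>s\<close> is the explicit preimage.\<close>

lemma exists_pair_weights:
  fixes q :: "nat \<Rightarrow> nat \<Rightarrow> real"
  assumes "n \<ge> 3" and q_sym: "\<And>a b. q a b = q b a" and q_diag: "\<And>a. q a a = 0"
  obtains s where "\<And>a b. s a b = s b a" "\<And>a. s a a = 0"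
    "\<And>a b. a \<le> n \<Longrightarrow> b \<le> n \<Longrightarrow> a \<noteq> b \<Longrightarrow> (\<Sum>i\<in>{..n} - {a, b}. \<Sum>j\<in>{..n} - {a, b}. s i j) = q a b"
proof -
  \<comment> \<open>If T is the total of \<open>s\<close> and R a its row sum, the system reads q a
    b = T - 2 R a - 2 R b + 2 s a b for distinct a, b. Summing over b gives (n-2)(T - 2 R a), so
    \<open>Q a\<close> is T - 2 R a; summing \<open>Q\<close> over a gives (n-1) T, so
    \<open>W\<close> is T. Solving for s a b yields the formula below.\<close>
  define Q where "Q a = (\<Sum>j\<le>n. q a j) / (real n - 2)" for a
  define W where "W = (\<Sum>a\<le>n. Q a) / (real n - 1)"
  define s where "s a b = (if a = b then 0 else (q a b + W - Q a - Q b) / 2)" for a b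
  have Q: "(\<Sum>j\<le>n. q a j) = (real n - 2) * Q a" for a using assms(1) by (simp add: Q_def)
  have W: "(\<Sum>a\<le>n. Q a) = (real n - 1) * W" using assms(1) by (simp add: W_def)
  have sym: "s a b = s b a" for a b using q_sym[of a b] by (auto simp: s_def)
  have diag: "s a a = 0" for a by (simp add: s_def)
  have row: "(\<Sum>j\<le>n. s a j) = (W - Q a) / 2" if "a \<le> n" for a
  proof -
    \<comment> \<open>The correction removes the value that the off-diagonal formula would take at
      \<open>j = a\<close>, where \<open>s\<close> is set to 0.\<close>
    have "(\<Sum>j\<le>n. s a j) = (\<Sum>j\<le>n. (q a j + W - Q a - Q j) / 2 - (if j = a then (W - 2 * Q a) / 2 else 0))"
      by (intro sum.cong) (auto simp: s_def q_diag)
    also have "\<dots> = ((real n - 2) * Q a + (real n + 1) * (W - Q a) - (real n - 1) * W) / 2 - (W - 2 * Q a) / 2"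
      using that by (simp add: sum_subtractf sum.distrib Q W sum_divide_distrib[symmetric] algebra_simps)
    also have "\<dots> = (W - Q a) / 2" by (simp add: field_simps)
    finally show ?thesis .
  qed
  have total: "(\<Sum>i\<le>n. \<Sum>j\<le>n. s i j) = W"
    by (simp add: row sum_divide_distrib[symmetric] sum_subtractf W algebra_simps)
  show thesis
  proof (rule that[of s, OF sym diag])
    fix a b assume ab: "a \<le> n" "b \<le> n" "a \<noteq> b"
    have minus: "(\<Sum>i\<in>{..n} - {a, b}. f i) = (\<Sum>i\<le>n. f i) - f a - f b" for f :: "nat \<Rightarrow> real"
      using ab by (subst sum_diff) auto
    have column: "(\<Sum>i\<le>n. s i c) = (W - Q c) / 2" if "c \<le> n" for c
      unfolding sym[of _ c] using that by (rule row)
    have "(\<Sum>i\<in>{..n} - {a, b}. \<Sum>j\<in>{..n} - {a, b}. s i j)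
        = W - 2 * ((W - Q a) / 2) - 2 * ((W - Q b) / 2) + 2 * s a b"
      unfolding minus sum_subtractf total using ab
      by (simp add: row column diag sym[of b a] field_simps)
    then show "(\<Sum>i\<in>{..n} - {a, b}. \<Sum>j\<in>{..n} - {a, b}. s i j) = q a b"
      using ab by (simp add: s_def field_simps)
  qed
qed

section \<open>Algebraic independence\<close>

theorem theorem1:
  fixes P :: "(nat set \<Rightarrow>\<^sub>0 nat) \<Rightarrow>\<^sub>0 complex"
  assumes "CARD('n) \<ge> 3"
    and "mpoly_vars P \<subseteq> codim2_faces CARD('n)"
    and "\<forall>v :: nat \<Rightarrow> real ^ 'n. nondeg_simplex v \<longrightarrow>
           mpoly_eval P (\<lambda>F. complex_of_real (face_volume v F)) = 0"
  shows "P = 0"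
proof -
  define n where "n = CARD('n)"
  obtain b :: "nat \<Rightarrow> real ^ 'n"
    where b: "\<And>i j. i \<le> n \<Longrightarrow> j \<le> n \<Longrightarrow> b i \<bullet> b j = of_bool (i = j) - 1 / (real n + 1)"
    using exists_regular_simplex[OF n_def] by blast
  \<comment> \<open>The denominator in the derivative of a face volume, for faces with n - 1
    vertices; \<open>y\<close> is the common volume of these faces in the regular simplex.\<close>
  define \<kappa> :: real where "\<kappa> = sqrt (real (n - 1)) * fact (n - 2)"
  define y where "y = sqrt (real (n - 1)) / fact (n - 2)"
  show ?thesis
  proof (rule mpoly_eq_0_of_curves[where x = "\<lambda>_. y"])
    fix u :: "nat set \<Rightarrow> real"
    \<comment> \<open>The target for the face opposite to {a,c}, scaled so that its volume gets
      derivative exactly \<open>u\<close>.\<close>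
    define q where "q a c = (if a = c then 0 else - \<kappa> * u ({..n} - {a, c}))" for a c
    have "q a c = q c a" for a c by (simp add: q_def insert_commute)
    then obtain s where s: "\<And>a c. s a c = s c a" "\<And>a. s a a = 0"
      "\<And>a c. a \<le> n \<Longrightarrow> c \<le> n \<Longrightarrow> a \<noteq> c \<Longrightarrow>
        (\<Sum>i\<in>{..n} - {a, c}. \<Sum>j\<in>{..n} - {a, c}. s i j) = q a c"
      using exists_pair_weights[of n q] assms(1) by (auto simp: q_def n_def)
    interpret perturbed_regular_simplex b s n
      by unfold_locales (use n_def b s in auto)
    \<comment> \<open>The difference quotient: \<open>y + t * w t F\<close> is the actual volume for
      t > 0, and the limit of \<open>w t F\<close> is its derivative.\<close>
    define w where "w t F = (face_volume (vertex t) F - y) / t" for t F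
    have "((\<lambda>t. w t F) \<longlongrightarrow> u F) (at_right 0)" if "F \<in> mpoly_vars P" for F
    proof -
      have F: "F \<subseteq> {..n}" "card F = n - 1"
        using that assms(2) by (auto simp: codim2_faces_def n_def atLeast0AtMost)
      have "card ({..n} - F) = 2"
        using F assms(1) by (subst card_Diff_subset) (auto intro: finite_subset simp: n_def)
      then obtain a c where ac: "{..n} - F = {a, c}" "a \<noteq> c" by (auto simp: card_2_iff)
      then have "F = {..n} - {a, c}" "a \<le> n" "c \<le> n" using F(1) by auto
      then have sum: "(\<Sum>i\<in>F. \<Sum>j\<in>F. s i j) = - \<kappa> * u F"
        using s(3)[of a c] ac(2) by (simp add: q_def)
      have "F \<noteq> {}" using F(2) assms(1) by (auto simp: n_def)
      note F' = F(1) this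
      have "((\<lambda>t. face_volume (vertex t) F) has_real_derivative u F) (at 0)"
        using has_real_derivative_face_volume[OF F'] assms(1) n_def unfolding sum F(2)
        by (simp add: \<kappa>_def numeral_2_eq_2)
      then have "((\<lambda>t. w t F) \<longlongrightarrow> u F) (at 0)"
        using face_volume_vertex_0[OF F'] unfolding DERIV_def w_def F(2)
        by (simp add: y_def numeral_2_eq_2)
      then show ?thesis by (rule tendsto_mono[OF at_le, rotated]) simp
    qed
    moreover have "\<forall>\<^sub>F t in at_right 0. mpoly_eval P (\<lambda>F. of_real (y + t * w t F)) = 0"
      using eventually_nondeg_vertex eventually_at_right_less[of 0]
    proof eventually_elim
      case (elim t)
      then have "y + t * w t F = face_volume (vertex t) F" for F by (simp add: w_def)
      then show ?case using assms(3) elim by simp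
    qed
    ultimately show "\<exists>w. (\<forall>F\<in>mpoly_vars P. ((\<lambda>t. w t F) \<longlongrightarrow> u F) (at_right 0)) \<and>
        (\<forall>\<^sub>F t in at_right 0. mpoly_eval P (\<lambda>F. complex_of_real (y + t * w t F)) = 0)"
      by blast
  qed
qed

end
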